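(* Let $p$ be a prime, let $a,b,c,d\in\mathbb{F}_p\setminus\{0\}$ and let $n\ge 2$. Let $T_{f,n}:\mathbb{F}_p^{V_n}\to\mathbb{F}_p^{V_n}$ be the finite linear cellular automaton with coefficients $a,b,c,d$ on the Cayley tree of order two with $n$ levels under the null boundary condition. Then the transition rule matrix $M_R^{(n)}$ of $T_{f,n}$, a square matrix of size $1+3(2^n-1)$ over $\mathbb{F}_p$, is the block tridiagonal matrix $$ M_R^{(n)}=\begin{pmatrix} d & P & 0 & \cdots & 0 & 0 & 0\\ Q & D_{3\times 3} & B_{3\times 6} & 0 & \cdots & 0 & 0\\ 0 & C_{6\times 3} & D_{6\times 6} & B_{6\times 12} & 0 & \cdots & 0\\ \vdots & \vdots & \ddots & \ddots & \ddots & \vdots & \vdots\\ 0 & \cdots & 0 & C_{3\cdot 2^{n-3}\times 3\cdot 2^{n-4}} & D_{3\cdot 2^{n-3}\times 3\cdot 2^{n-3}} & B_{3\cdot 2^{n-3}\times 3\cdot 2^{n-2}} & 0\\ 0 & 0 & \cdots & 0 & C_{3\cdot 2^{n-2}\times 3\cdot 2^{n-3}} & D_{3\cdot 2^{n-2}\times 3\cdot 2^{n-2}} & B_{3\cdot 2^{n-2}\times 3\cdot 2^{n-1}}\\ 0 & 0 & 0 & \cdots & 0 & C_{3\cdot 2^{n-1}\times 3\cdot 2^{n-2}} & D_{3\cdot 2^{n-1}\times 3\cdot 2^{n-1}} \end{pmatrix}, $$ that is, its block rows and block columns are indexed by the levels $0,1,\dots,n$ (level $0$ having size $1$ and level $m\ge1$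 having size $3\cdot 2^{m-1}$), all blocks not on the three central block diagonals are zero, and the remaining blocks are as follows. (i) The level $(0,0)$ block is $d$; the level $(0,1)$ block is $P=(a\ \ b\ \ c)$; the level $(1,0)$ block is $Q=(c\ \ c\ \ c)^T$. (ii) For $1\le m\le n$, the level $(m,m)$ block is $D_{3\cdot 2^{m-1}\times 3\cdot 2^{m-1}}=d\cdot I_{3\cdot 2^{m-1}}$, where $I$ is the identity matrix. (iii) For $1\le m\le n-1$, the level $(m,m+1)$ block is the matrix $B_{3\cdot 2^{m-1}\times 3\cdot 2^{m}}$ whose $j$-th row ($1\le j\le 3\cdot 2^{m-1}$) has entry $a$ in column $2j-1$, entry $b$ in column $2j$, and zeros elsewhere. (iv) For $1\le m\le n-1$, the level $(m+1,m)$ block is the matrix $C_{3\cdot 2^{m}\times 3\cdot 2^{m-1}}$ whose $j$-th column ($1\le j\le 3\cdot 2^{m-1}$) has entry $c$ in rows $2j-1$ and $2j$, and zeros elsewhere.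
   Context: The Cayley tree $\Gamma^2$ of order two is the infinite tree, with vertex set $V$, in which every vertex has exactly three neighbours; a root $x_0$ is fixed. The three neighbours of the root are labelled $x_1,x_2,x_3$. Every non-root vertex $x_w$ is labelled by a word $w$ with first letter in $\{1,2,3\}$ and all other letters in $\{1,2\}$; its two children are $x_{w1}$ and $x_{w2}$, and its parent is obtained by deleting the last letter of $w$ (the parent of $x_1,x_2,x_3$ is $x_0$). $W_m$ is the set of vertices at distance exactly $m$ from the root ($|W_m|=3\cdot 2^{m-1}$ for $m\ge1$), and $V_n$ is the set of vertices at distance at most $n$ ($|V_n|=1+3(2^n-1)$). Vertices of $V_n$ are ordered level by level ($W_0=\{x_0\}$ first, then $W_1$, ..., then $W_n$), and inside each level lexicographically by their labels. The linear local rules with coefficients $a,b,c,d$ are as follows. If $x_w^{(t)}\in\mathbb{F}_p$ denotes the state of vertex $x_w$ at time $t$, then for the root $$x_0^{(t+1)}=a x_1^{(t)}+b x_2^{(t)}+c x_3^{(t)}+d x_0^{(t)} \pmod p,$$ and for a non-root vertex $x_w$ with parent $x_{w'}$ $$x_w^{(t+1)}=a x_{w1}^{(t)}+b x_{w2}^{(t)}+c x_{w'}^{(t)}+d x_w^{(t)} \pmod p.$$ Null boundary condition with $n$ levels: the states of all vertices outside $V_n$ are fixed to be $0$. The finite cellular automaton $T_{f,n}:\mathbb{F}_p^{V_n}\to\mathbb{F}_p^{V_n}$ applies the local rules at every vertex of $V_n$ with the states of vertices outside $V_n$ taken to be $0$. The transition rule matrix $M_R^{(n)}$ of $T_{f,n}$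 is the matrix over $\mathbb{F}_p$ such that, writing $X^{(t)}$ for the column vector of states of the vertices of $V_n$ listed level by level ($W_0=\{x_0\}$ first, then $W_1$, ..., then $W_n$) and lexicographically by label inside each level, $M_R^{(n)}X^{(t)}=X^{(t+1)}$ for every configuration, where $X^{(t+1)}$ is the column vector of the image configuration under $T_{f,n}$. *)

theory Defs
  imports
    "HOL-Library.FuncSet"
    "HOL-Library.List_Lexorder"
    "Jordan_Normal_Form.Matrix"
    "Berlekamp_Zassenhaus.Finite_Field"
begin

text \<open>
  The vertex \<open>x\<^sub>w\<close> of the Cayley tree of order two is represented by its label, the word \<open>w\<close>
  with first letter in \<open>{1,2,3}\<close> and all other letters in \<open>{1,2}\<close>; the root \<open>x\<^sub>0\<close> is the empty
  word. Deleting the last letter (\<open>butlast\<close>) gives the parent.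
\<close>

definition cayley_vertices :: "nat list set" where
  "cayley_vertices = {w. w = [] \<or> hd w \<in> {1, 2, 3} \<and> set (tl w) \<subseteq> {1, 2}}"

definition cayley_edges :: "(nat list \<times> nat list) set" where
  "cayley_edges =
     {(u, v). u \<in> cayley_vertices \<and> v \<in> cayley_vertices \<and>
              (v \<noteq> [] \<and> u = butlast v \<or> u \<noteq> [] \<and> v = butlast u)}"

definition cayley_dist :: "nat list \<Rightarrow> nat list \<Rightarrow> nat" where
  "cayley_dist u v = (LEAST k. (u, v) \<in> cayley_edges ^^ k)"

definition level :: "nat \<Rightarrow> nat list set" where
  "level m = {v \<in> cayley_vertices. cayley_dist [] v = m}"

definition tree_ball :: "nat \<Rightarrow> nat list set" where
  "tree_ball n = {v \<in> cayley_vertices. cayley_dist [] v \<le> n}"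

text \<open>
  The order on lists is the lexicographic one provided by \<open>List_Lexorder\<close>, so this lists the
  ball level by level and lexicographically inside each level.
\<close>

definition vertex_list :: "nat \<Rightarrow> nat list list" where
  "vertex_list n = concat (map (\<lambda>m. sorted_list_of_set (level m)) [0..<Suc n])"

definition local_rule ::
  "'a::comm_ring_1 \<Rightarrow> 'a \<Rightarrow> 'a \<Rightarrow> 'a \<Rightarrow> (nat list \<Rightarrow> 'a) \<Rightarrow> nat list \<Rightarrow> 'a" where
  "local_rule a b c d x w =
     (if w = [] then a * x [1] + b * x [2] + c * x [3] + d * x []
      else a * x (w @ [1]) + b * x (w @ [2]) + c * x (butlast w) + d * x w)"

text \<open>
  A configuration in \<open>\<F>\<^sub>p\<close> to the power \<open>V\<^sub>n\<close> is an extensional function on the ball (see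
  \<open>PiE\<close>); the null boundary condition extends it by \<open>0\<close> before the local rules are applied.
\<close>

definition configurations :: "nat \<Rightarrow> (nat list \<Rightarrow> 'a) set" where
  "configurations n = tree_ball n \<rightarrow>\<^sub>E UNIV"

definition null_extension :: "nat \<Rightarrow> (nat list \<Rightarrow> 'a::zero) \<Rightarrow> nat list \<Rightarrow> 'a" where
  "null_extension n x v = (if v \<in> tree_ball n then x v else 0)"

definition null_boundary_ca ::
  "nat \<Rightarrow> 'a::comm_ring_1 \<Rightarrow> 'a \<Rightarrow> 'a \<Rightarrow> 'a \<Rightarrow> (nat list \<Rightarrow> 'a) \<Rightarrow> (nat list \<Rightarrow> 'a)" where
  "null_boundary_ca n a b c d x =
     (\<lambda>w \<in> tree_ball n. local_rule a b c d (null_extension n x) w)"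

definition state_vec :: "nat \<Rightarrow> (nat list \<Rightarrow> 'a) \<Rightarrow> 'a vec" where
  "state_vec n x = vec_of_list (map x (vertex_list n))"

definition is_transition_rule_matrix ::
  "nat \<Rightarrow> ((nat list \<Rightarrow> 'a::comm_ring_1) \<Rightarrow> (nat list \<Rightarrow> 'a)) \<Rightarrow> 'a mat \<Rightarrow> bool" where
  "is_transition_rule_matrix n T M \<longleftrightarrow>
     M \<in> carrier_mat (card (tree_ball n)) (card (tree_ball n)) \<and>
     (\<forall>x \<in> configurations n. M *\<^sub>v state_vec n x = state_vec n (T x))"

definition transition_rule_matrix ::
  "nat \<Rightarrow> ((nat list \<Rightarrow> 'a::comm_ring_1) \<Rightarrow> (nat list \<Rightarrow> 'a)) \<Rightarrow> 'a mat" where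
  "transition_rule_matrix n T = (THE M. is_transition_rule_matrix n T M)"

definition level_size :: "nat \<Rightarrow> nat" where
  "level_size m = (if m = 0 then 1 else 3 * 2 ^ (m - 1))"

definition level_offset :: "nat \<Rightarrow> nat" where
  "level_offset m = (\<Sum>k<m. level_size k)"

definition level_block :: "'a mat \<Rightarrow> nat \<Rightarrow> nat \<Rightarrow> 'a mat" where
  "level_block M k l =
     mat (level_size k) (level_size l) (\<lambda>(i, j). M $$ (level_offset k + i, level_offset l + j))"

text \<open>
  Matrix indices start at \<open>0\<close>: the 1-based positions \<open>2j - 1\<close> and \<open>2j\<close> attached to the 1-based
  index \<open>j\<close> are the positions \<open>2i\<close> and \<open>2i + 1\<close> attached to \<open>i = j - 1\<close>.
\<close>

definition block_B :: "'a::zero \<Rightarrow> 'a \<Rightarrow> nat \<Rightarrow> 'a mat" where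
  "block_B a b N =
     mat N (2 * N) (\<lambda>(i, j). if j = 2 * i then a else if j = 2 * i + 1 then b else 0)"

definition block_C :: "'a::zero \<Rightarrow> nat \<Rightarrow> 'a mat" where
  "block_C c N = mat (2 * N) N (\<lambda>(i, j). if i = 2 * j \<or> i = 2 * j + 1 then c else 0)"

end

theory Submission
  imports Defs
begin

text \<open>
  Column \<open>j\<close> of the matrix of a linear map is the image of the \<open>j\<close>-th unit configuration, so the
  entry belonging to the vertices \<open>w\<close> (row) and \<open>v\<close> (column) must be the local rule at \<open>w\<close>
  evaluated on the configuration that is \<open>1\<close> at \<open>v\<close> and \<open>0\<close> elsewhere
  (\<open>transition_rule_matrix_entry\<close>). Since the local rule is linear, the matrix with these
  entries does represent the automaton (\<open>rule_matrix_represents\<close>), so it is the unique one.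
  For \<open>w\<close> not the root, that entry is \<open>a\<close>, \<open>b\<close>, \<open>c\<close> or \<open>d\<close> according to whether \<open>v\<close> is the first
  child, the second child or the parent of \<open>w\<close>, or \<open>w\<close> itself, and it is \<open>0\<close> otherwise; for the
  root, which has no parent, \<open>c\<close> belongs to its third child. As the distance of a vertex
  from the root is the length of its label, only blocks of equal or adjacent levels survive.

  It remains to locate children and parents inside a level. Appending a last letter to words of
  equal length preserves their lexicographic order, so level \<open>m + 1\<close> in lexicographic order arises
  from level \<open>m \<ge> 1\<close> by replacing each word \<open>w\<close> in place by \<open>w1, w2\<close>
  (\<open>sorted_level\<close>). With positions counted from \<open>0\<close>, the children of the \<open>j\<close>-th vertex therefore
  stand at positions \<open>2j\<close> and \<open>2j + 1\<close> of the next level, which is the shape of the blocks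
  \<open>B\<close> and \<open>C\<close>.
\<close>

section \<open>Levels of the tree as sets of words\<close>

lemma Nil_in_cayley_vertices: "[] \<in> cayley_vertices"
  by (simp add: cayley_vertices_def)

lemma singleton_in_cayley_vertices: "[x] \<in> cayley_vertices \<longleftrightarrow> x \<in> {1, 2, 3}"
  by (simp add: cayley_vertices_def)

lemma snoc_in_cayley_vertices:
  assumes "w \<noteq> []"
  shows "w @ [x] \<in> cayley_vertices \<longleftrightarrow> w \<in> cayley_vertices \<and> x \<in> {1, 2}"
  using assms by (auto simp: cayley_vertices_def)

lemma butlast_in_cayley_vertices:
  assumes "w @ [x] \<in> cayley_vertices"
  shows "w \<in> cayley_vertices"
  using assms snoc_in_cayley_vertices Nil_in_cayley_vertices by (cases "w = []") auto

lemma length_le_of_path: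
  assumes "(u, v) \<in> cayley_edges ^^ k"
  shows "length v \<le> length u + k"
  using assms
proof (induction k arbitrary: v)
  case (Suc k)
  then obtain z where z: "(u, z) \<in> cayley_edges ^^ k" and e: "(z, v) \<in> cayley_edges"
    by auto
  from e have "length v \<le> length z + 1"
    by (auto simp: cayley_edges_def)
  with Suc.IH[OF z] show ?case by simp
qed simp

lemma path_from_root:
  assumes "v \<in> cayley_vertices"
  shows "([], v) \<in> cayley_edges ^^ length v"
  using assms
proof (induction v rule: rev_induct)
  case (snoc x w)
  from snoc.prems have w: "w \<in> cayley_vertices" by (rule butlast_in_cayley_vertices)
  have "(w, w @ [x]) \<in> cayley_edges"
    using w snoc.prems by (simp add: cayley_edges_def)
  with snoc.IH[OF w] show ?case by auto
qed simp

text \<open>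
  An edge changes the length of a label by one, so no path from the root is shorter than the
  label of its endpoint; spelling out the prefixes of the label gives a path of that length.
\<close>
lemma cayley_dist_root:
  assumes "v \<in> cayley_vertices"
  shows "cayley_dist [] v = length v"
  unfolding cayley_dist_def
proof (rule Least_equality)
  show "([], v) \<in> cayley_edges ^^ length v" by (rule path_from_root[OF assms])
  show "length v \<le> k" if "([], v) \<in> cayley_edges ^^ k" for k
    using length_le_of_path[OF that] by simp
qed

lemma level_eq: "level m = {v \<in> cayley_vertices. length v = m}"
  by (auto simp: level_def cayley_dist_root)

lemma tree_ball_eq: "tree_ball n = {v \<in> cayley_vertices. length v \<le> n}"
  by (auto simp: tree_ball_def cayley_dist_root)

lemma level_0: "level 0 = {[]}"
  by (auto simp: level_eq Nil_in_cayley_vertices)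

lemma level_1: "level (Suc 0) = {[1], [2], [3]}"
  by (auto simp: level_eq length_Suc_conv singleton_in_cayley_vertices)

lemma level_Suc:
  assumes "m \<ge> 1"
  shows "level (Suc m) = (\<Union>w \<in> level m. {w @ [1], w @ [2]})"
proof (intro subset_antisym subsetI)
  fix v assume v: "v \<in> level (Suc m)"
  then obtain w x where v_eq: "v = w @ [x]" and len: "length w = m"
    by (cases v rule: rev_cases) (auto simp: level_eq)
  from len assms have "w \<noteq> []" by auto
  with v v_eq len show "v \<in> (\<Union>w \<in> level m. {w @ [1], w @ [2]})"
    by (auto simp: level_eq snoc_in_cayley_vertices)
next
  fix v assume "v \<in> (\<Union>w \<in> level m. {w @ [1], w @ [2]})"
  then obtain w x where "w \<in> level m" "v = w @ [x]" "x \<in> {1, 2}" by auto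
  moreover from this assms have "w \<noteq> []" by (auto simp: level_eq)
  ultimately show "v \<in> level (Suc m)"
    by (auto simp: level_eq snoc_in_cayley_vertices)
qed

section \<open>The lexicographic listing of a level\<close>

text \<open>
  Levels \<open>0\<close> and \<open>1\<close> are base cases because the root has three children, not two.
\<close>
fun level_list :: "nat \<Rightarrow> nat list list" where
  "level_list 0 = [[]]"
| "level_list (Suc 0) = [[1], [2], [3]]"
| "level_list (Suc (Suc m)) = concat (map (\<lambda>w. [w @ [1], w @ [2]]) (level_list (Suc m)))"

lemma set_level_list: "set (level_list m) = level m"
  by (induction m rule: level_list.induct) (simp_all only: level_list.simps level_0 level_1, auto simp: level_Suc)

lemma length_concat_pairs: "length (concat (map (\<lambda>w. [f w, g w]) ws)) = 2 * length ws"
  by (induction ws) auto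

lemma nth_concat_pairs:
  assumes "j < length ws"
  shows "concat (map (\<lambda>w. [f w, g w]) ws) ! (2 * j) = f (ws ! j)"
    and "concat (map (\<lambda>w. [f w, g w]) ws) ! (2 * j + 1) = g (ws ! j)"
  using assms
proof (induction ws arbitrary: j)
  case (Cons w ws)
  {
    case 1
    with Cons.IH(1) show ?case by (cases j) auto
  next
    case 2
    with Cons.IH(2) show ?case by (cases j) auto
  }
qed auto

lemma length_level_list: "length (level_list m) = level_size m"
  by (induction m rule: level_list.induct)
    (simp_all only: level_list.simps length_concat_pairs, simp_all add: level_size_def)

lemma length_in_level_list:
  assumes "i < level_size m"
  shows "length (level_list m ! i) = m"
  using assms nth_mem[of i "level_list m"]
  by (simp add: set_level_list length_level_list level_eq)

lemma level_list_child:
  assumes "m \<ge> 1" and "j < level_size m"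
  shows "level_list (Suc m) ! (2 * j) = level_list m ! j @ [1]"
    and "level_list (Suc m) ! (2 * j + 1) = level_list m ! j @ [2]"
proof -
  from assms(1) obtain k where m: "m = Suc k" by (cases m) auto
  show "level_list (Suc m) ! (2 * j) = level_list m ! j @ [1]"
    and "level_list (Suc m) ! (2 * j + 1) = level_list m ! j @ [2]"
    using nth_concat_pairs[of j "level_list m" "\<lambda>w. w @ [1]" "\<lambda>w. w @ [2]"] assms(2)
    by (simp_all add: m length_level_list)
qed

text \<open>
  The equal lengths matter: if \<open>u\<close> were a proper prefix of \<open>v\<close>, the letter appended to \<open>u\<close> could
  exceed the next letter of \<open>v\<close>.
\<close>
lemma snoc_less_snoc:
  fixes u v :: "'a::order list"
  assumes "u < v" and "length u = length v"
  shows "u @ [x] < v @ [y]"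
  using assms unfolding list_less_def by (intro lexord_sufI) auto

lemma sorted_wrt_concat_children:
  fixes ws :: "nat list list"
  assumes "sorted_wrt (<) ws" and "\<And>w. w \<in> set ws \<Longrightarrow> length w = m"
  shows "sorted_wrt (<) (concat (map (\<lambda>w. [w @ [1], w @ [2]]) ws))"
  using assms
proof (induction ws)
  case (Cons w ws)
  have "w @ [1] < w @ [2]"
    by (induction w) auto
  moreover have "w @ [x] < v @ [y]" if "v \<in> set ws" for x y v
    using Cons.prems that by (intro snoc_less_snoc) auto
  ultimately show ?case using Cons by auto
qed simp

lemma sorted_wrt_level_list: "sorted_wrt (<) (level_list m)"
proof (induction m rule: level_list.induct)
  case (3 m)
  show ?case unfolding level_list.simps
    using 3 by (rule sorted_wrt_concat_children[where m = "Suc m"]) (simp add: set_level_list level_eq)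
qed auto

lemma distinct_level_list: "distinct (level_list m)"
  using sorted_wrt_level_list strict_sorted_iff by blast

lemma sorted_level: "sorted_list_of_set (level m) = level_list m"
  using sorted_wrt_level_list[of m] unfolding set_level_list[symmetric] strict_sorted_iff
  by (simp add: sorted_list_of_set.idem_if_sorted_distinct)

section \<open>Positions in the enumeration of the ball\<close>

lemma vertex_list_eq: "vertex_list n = concat (map level_list [0..<Suc n])"
  by (simp only: vertex_list_def sorted_level)

lemma vertex_list_Suc: "vertex_list (Suc n) = vertex_list n @ level_list (Suc n)"
  by (simp add: vertex_list_eq)

lemma set_vertex_list: "set (vertex_list n) = tree_ball n"
  by (auto simp: vertex_list_eq set_level_list level_eq tree_ball_eq)

lemma finite_tree_ball: "finite (tree_ball n)"
  by (metis List.finite_set set_vertex_list)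

lemma distinct_vertex_list: "distinct (vertex_list n)"
proof (induction n)
  case 0
  show ?case by (simp add: vertex_list_eq)
next
  case (Suc n)
  then show ?case
    by (auto simp: vertex_list_Suc distinct_level_list set_vertex_list set_level_list
        tree_ball_eq level_eq simp del: level_list.simps)
qed

lemma level_offset_Suc: "level_offset (Suc k) = level_offset k + level_size k"
  by (simp add: level_offset_def)

lemma level_offset_closed: "level_offset (Suc n) = 1 + 3 * (2 ^ n - 1)"
proof (induction n)
  case (Suc n)
  have "(1::nat) \<le> 2 ^ n" by simp
  with Suc show ?case
    by (simp add: level_offset_Suc[of "Suc n"] level_size_def algebra_simps)
qed (simp add: level_offset_def level_size_def)

lemma level_offset_less:
  assumes "k \<le> n" and "i < level_size k"
  shows "level_offset k + i < level_offset (Suc n)"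
proof -
  have "level_offset (Suc k) \<le> level_offset (Suc n)"
    unfolding level_offset_def using assms(1) by (intro sum_mono2) auto
  with assms(2) show ?thesis by (simp add: level_offset_Suc)
qed

lemma length_vertex_list: "length (vertex_list n) = level_offset (Suc n)"
proof (induction n)
  case 0
  show ?case by (simp add: vertex_list_eq level_offset_def level_size_def)
next
  case (Suc n)
  then show ?case
    by (simp add: vertex_list_Suc length_level_list level_offset_Suc[of "Suc n"] del: level_list.simps)
qed

lemma card_tree_ball: "card (tree_ball n) = level_offset (Suc n)"
  using distinct_card[OF distinct_vertex_list[of n]] by (simp add: set_vertex_list length_vertex_list)

lemma nth_vertex_list:
  assumes "k \<le> n" and "i < level_size k"
  shows "vertex_list n ! (level_offset k + i) = level_list k ! i"
  using assms
proof (induction n)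
  case 0
  then show ?case by (simp add: vertex_list_eq level_offset_def)
next
  case (Suc n)
  show ?case
  proof (cases "k = Suc n")
    case True
    then show ?thesis by (simp add: vertex_list_Suc nth_append length_vertex_list del: level_list.simps)
  next
    case False
    with Suc.prems have "k \<le> n" by simp
    with Suc show ?thesis
      by (simp add: vertex_list_Suc nth_append length_vertex_list level_offset_less del: level_list.simps)
  qed
qed

section \<open>Existence, uniqueness and entries of the transition rule matrix\<close>

definition unit_config :: "'v \<Rightarrow> 'v \<Rightarrow> 'a::zero_neq_one" where
  "unit_config v u = (if u = v then 1 else 0)"

lemma state_vec_unit_config:
  assumes "j < card (tree_ball n)"
  shows "state_vec n (restrict (unit_config (vertex_list n ! j)) (tree_ball n))
    = (unit_vec (card (tree_ball n)) j :: 'a::comm_ring_1 vec)"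
proof (rule eq_vecI)
  fix i assume "i < dim_vec (unit_vec (card (tree_ball n)) j :: 'a vec)"
  then have i: "i < length (vertex_list n)" by (simp add: card_tree_ball length_vertex_list)
  have j: "j < length (vertex_list n)" using assms by (simp add: card_tree_ball length_vertex_list)
  have "vertex_list n ! i \<in> tree_ball n" using nth_mem[OF i] by (simp add: set_vertex_list)
  with i j show "state_vec n (restrict (unit_config (vertex_list n ! j)) (tree_ball n)) $ i
      = (unit_vec (card (tree_ball n)) j :: 'a vec) $ i"
    by (simp add: state_vec_def vec_of_list_index unit_config_def card_tree_ball
        length_vertex_list[symmetric] nth_eq_iff_index_eq[OF distinct_vertex_list])
qed (simp add: state_vec_def card_tree_ball length_vertex_list)

text \<open>
  Unit configurations pick out columns, so any map has at most one matrix.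
\<close>
lemma transition_rule_matrix_column:
  fixes M :: "'a::comm_ring_1 mat"
  assumes M: "is_transition_rule_matrix n T M"
    and i: "i < card (tree_ball n)" and j: "j < card (tree_ball n)"
  shows "M $$ (i, j)
    = T (restrict (unit_config (vertex_list n ! j)) (tree_ball n)) (vertex_list n ! i)"
proof -
  let ?e = "restrict (unit_config (vertex_list n ! j)) (tree_ball n) :: nat list \<Rightarrow> 'a"
  have carr: "M \<in> carrier_mat (card (tree_ball n)) (card (tree_ball n))"
    using M by (simp add: is_transition_rule_matrix_def)
  have "?e \<in> configurations n" by (simp add: configurations_def)
  with M have "M *\<^sub>v state_vec n ?e = state_vec n (T ?e)"
    by (simp add: is_transition_rule_matrix_def)
  then have "M *\<^sub>v unit_vec (card (tree_ball n)) j = state_vec n (T ?e)"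
    by (simp add: state_vec_unit_config[OF j])
  then have "(M *\<^sub>v unit_vec (card (tree_ball n)) j) $ i = state_vec n (T ?e) $ i" by simp
  moreover have "(M *\<^sub>v unit_vec (card (tree_ball n)) j) $ i = M $$ (i, j)"
    using carr i j by (simp add: scalar_prod_right_unit)
  ultimately show ?thesis
    using i by (simp add: state_vec_def vec_of_list_index card_tree_ball length_vertex_list)
qed

lemma transition_rule_matrix_entry:
  assumes M: "is_transition_rule_matrix n (null_boundary_ca n a b c d) M"
    and i: "i < card (tree_ball n)" and j: "j < card (tree_ball n)"
  shows "M $$ (i, j)
    = local_rule a b c d (unit_config (vertex_list n ! j)) (vertex_list n ! i)"
proof -
  have mem: "vertex_list n ! k \<in> tree_ball n" if "k < card (tree_ball n)" for k
    using that nth_mem[of k "vertex_list n"]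
    by (simp add: set_vertex_list card_tree_ball length_vertex_list)
  have "null_extension n (restrict (unit_config (vertex_list n ! j)) (tree_ball n))
      = (unit_config (vertex_list n ! j) :: _ \<Rightarrow> 'a)"
    using mem[OF j] by (auto simp: null_extension_def unit_config_def)
  then show ?thesis
    using transition_rule_matrix_column[OF M i j] mem[OF i] by (simp add: null_boundary_ca_def)
qed

text \<open>
  Linearity of the local rule, in the form of its expansion over unit configurations.
\<close>
lemma local_rule_expansion:
  assumes "finite B" and "\<And>u. u \<notin> B \<Longrightarrow> y u = 0"
  shows "local_rule a b c d y w = (\<Sum>v\<in>B. local_rule a b c d (unit_config v) w * y v)"
proof -
  have y: "y u = (\<Sum>v\<in>B. unit_config v u * y v)" for u
    using assms by (cases "u \<in> B") (auto simp: unit_config_def if_distrib[of "\<lambda>t. t * _"] sum.delta cong: if_cong)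
  show ?thesis
  proof (cases "w = []")
    case True
    then show ?thesis
      unfolding local_rule_def
      by (subst y[of "[1]"], subst y[of "[2]"], subst y[of "[3]"], subst y[of "[]"])
        (simp add: sum_distrib_left sum.distrib algebra_simps)
  next
    case False
    then show ?thesis
      unfolding local_rule_def
      by (subst y[of "w @ [1]"], subst y[of "w @ [2]"], subst y[of "butlast w"], subst y[of w])
        (simp add: sum_distrib_left sum.distrib algebra_simps)
  qed
qed

text \<open>
  Row \<open>i\<close> of the product is a sum over positions; reindexed by vertices it is the expansion of the
  local rule for the configuration extended by \<open>0\<close>, which vanishes off the ball.
\<close>
lemma rule_matrix_represents:
  fixes a b c d :: "'a::comm_ring_1"
  shows "is_transition_rule_matrix n (null_boundary_ca n a b c d)
    (mat (card (tree_ball n)) (card (tree_ball n))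
      (\<lambda>(i, j). local_rule a b c d (unit_config (vertex_list n ! j)) (vertex_list n ! i)))"
    (is "is_transition_rule_matrix _ _ ?M")
  unfolding is_transition_rule_matrix_def
proof (intro conjI ballI)
  fix x :: "nat list \<Rightarrow> 'a"
  let ?N = "length (vertex_list n)"
  have N: "card (tree_ball n) = ?N" by (simp add: card_tree_ball length_vertex_list)
  show "?M *\<^sub>v state_vec n x = state_vec n (null_boundary_ca n a b c d x)"
  proof (rule eq_vecI)
    fix i assume "i < dim_vec (state_vec n (null_boundary_ca n a b c d x))"
    then have i: "i < ?N" by (simp add: state_vec_def)
    let ?w = "vertex_list n ! i"
    let ?L = "\<lambda>v. local_rule a b c d (unit_config v) ?w"
    have w: "?w \<in> tree_ball n" using nth_mem[OF i] by (simp add: set_vertex_list)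
    have "(?M *\<^sub>v state_vec n x) $ i = (\<Sum>j<?N. ?L (vertex_list n ! j) * x (vertex_list n ! j))"
      using i by (simp add: N scalar_prod_def state_vec_def vec_of_list_index atLeast0LessThan)
    also have "\<dots> = (\<Sum>v\<in>tree_ball n. ?L v * x v)"
      by (rule sum.reindex_bij_betw)
        (rule bij_betw_nth[OF distinct_vertex_list refl set_vertex_list[symmetric]])
    also have "\<dots> = (\<Sum>v\<in>tree_ball n. ?L v * null_extension n x v)"
      by (simp add: null_extension_def)
    also have "\<dots> = local_rule a b c d (null_extension n x) ?w"
      by (rule local_rule_expansion[symmetric]) (auto simp: finite_tree_ball null_extension_def)
    also have "\<dots> = state_vec n (null_boundary_ca n a b c d x) $ i"
      using i w by (simp add: state_vec_def vec_of_list_index null_boundary_ca_def)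
    finally show "(?M *\<^sub>v state_vec n x) $ i = state_vec n (null_boundary_ca n a b c d x) $ i" .
  qed (simp add: state_vec_def N)
qed simp

lemma ex1_transition_rule_matrix:
  fixes a b c d :: "'a::comm_ring_1"
  shows "\<exists>!M. is_transition_rule_matrix n (null_boundary_ca n a b c d) M"
proof (rule ex_ex1I)
  show "\<exists>M. is_transition_rule_matrix n (null_boundary_ca n a b c d) M"
    using rule_matrix_represents by blast
next
  fix M M' :: "'a mat"
  assume M: "is_transition_rule_matrix n (null_boundary_ca n a b c d) M"
    and M': "is_transition_rule_matrix n (null_boundary_ca n a b c d) M'"
  then have "M \<in> carrier_mat (card (tree_ball n)) (card (tree_ball n))"
    "M' \<in> carrier_mat (card (tree_ball n)) (card (tree_ball n))"
    by (simp_all add: is_transition_rule_matrix_def)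
  then show "M = M'"
    using transition_rule_matrix_entry[OF M] transition_rule_matrix_entry[OF M']
    by (intro eq_matI) auto
qed

section \<open>The blocks\<close>

text \<open>
  The listings of the levels do not depend on \<open>n\<close>, so neither does the block between two given
  levels; this reduces every block to a computation inside two listings.
\<close>
lemma level_block_eq:
  assumes M: "is_transition_rule_matrix n (null_boundary_ca n a b c d) M"
    and "k \<le> n" and "l \<le> n"
  shows "level_block M k l = mat (level_size k) (level_size l)
    (\<lambda>(i, j). local_rule a b c d (unit_config (level_list l ! j)) (level_list k ! i))"
  unfolding level_block_def
  using assms(2,3)
  by (intro cong_mat)
    (simp_all add: transition_rule_matrix_entry[OF M] card_tree_ball level_offset_less nth_vertex_list)

lemma local_rule_unit_root:
  "local_rule a b c d (unit_config v) [] =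
    (if v = [1] then a else if v = [2] then b else if v = [3] then c
     else if v = [] then d else 0)"
  by (auto simp: local_rule_def unit_config_def)

lemma local_rule_unit_nonroot:
  assumes "w \<noteq> []"
  shows "local_rule a b c d (unit_config v) w =
    (if v = w @ [1] then a else if v = w @ [2] then b else if v = butlast w then c
     else if v = w then d else 0)"
proof -
  have "butlast w \<noteq> w @ [x]" "butlast w \<noteq> w" for x
    using assms by (cases w rule: rev_cases; auto)+
  with assms show ?thesis by (auto simp: local_rule_def unit_config_def)
qed

lemma nth_level_list_eq_iff:
  assumes "i < level_size m" and "j < level_size m"
  shows "level_list m ! i = level_list m ! j \<longleftrightarrow> i = j"
  using assms by (simp add: nth_eq_iff_index_eq distinct_level_list length_level_list)

lemma level_size_Suc: "m \<ge> 1 \<Longrightarrow> level_size (Suc m) = 2 * level_size m"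
  by (cases m) (auto simp: level_size_def)

lemma level_list_Suc_nth:
  assumes "m \<ge> 1" and "j < level_size (Suc m)"
  shows "level_list (Suc m) ! j = level_list m ! (j div 2) @ [if even j then 1 else 2]"
proof -
  have "j div 2 < level_size m" using assms by (simp add: level_size_Suc)
  note child = level_list_child[OF assms(1) this]
  show ?thesis
  proof (cases "even j")
    case True
    then show ?thesis using child(1) by (simp del: level_list.simps)
  next
    case False
    then show ?thesis using child(2) by (simp del: level_list.simps)
  qed
qed

lemma far_block_entry:
  assumes "k + 1 < l \<or> l + 1 < k" and "i < level_size k" and "j < level_size l"
  shows "local_rule a b c d (unit_config (level_list l ! j)) (level_list k ! i) = 0"
proof -
  let ?w = "level_list k ! i" and ?v = "level_list l ! j"
  have len: "length ?w = k" "length ?v = l" using assms by (simp_all add: length_in_level_list)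
  show ?thesis
  proof (cases "?w = []")
    case True
    then have "k = 0" using len by simp
    with assms(1) len have "?v \<noteq> [x]" "?v \<noteq> []" for x by auto
    with True show ?thesis by (simp add: local_rule_unit_root)
  next
    case False
    have "?v \<noteq> ?w @ [x]" "?v \<noteq> butlast ?w" "?v \<noteq> ?w" for x
      using assms(1) len by (auto dest!: arg_cong[of _ _ length])
    with False show ?thesis by (simp add: local_rule_unit_nonroot)
  qed
qed

lemma diagonal_block_entry:
  assumes "i < level_size m" and "j < level_size m"
  shows "local_rule a b c d (unit_config (level_list m ! j)) (level_list m ! i)
    = (if i = j then d else 0)"
proof -
  let ?w = "level_list m ! i" and ?v = "level_list m ! j"
  have len: "length ?w = m" "length ?v = m" using assms by (simp_all add: length_in_level_list)
  have eq: "?v = ?w \<longleftrightarrow> i = j" using assms by (auto simp: nth_level_list_eq_iff)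
  show ?thesis
  proof (cases "?w = []")
    case True
    with len have "?v = []" by simp
    with True eq show ?thesis by (simp add: local_rule_unit_root)
  next
    case False
    with len(1) have "m \<noteq> 0" by (metis length_0_conv)
    with len have "?v \<noteq> ?w @ [x]" "?v \<noteq> butlast ?w" for x
      by (auto dest!: arg_cong[of _ _ length])
    with False eq show ?thesis by (simp add: local_rule_unit_nonroot)
  qed
qed

lemma child_block_entry:
  assumes "m \<ge> 1" and i: "i < level_size m" and j: "j < level_size (Suc m)"
  shows "local_rule a b c d (unit_config (level_list (Suc m) ! j)) (level_list m ! i)
    = (if j = 2 * i then a else if j = 2 * i + 1 then b else 0)"
proof -
  let ?w = "level_list m ! i" and ?v = "level_list (Suc m) ! j"
  have len: "length ?w = m" "length ?v = Suc m"
    using assms by (simp_all add: length_in_level_list del: level_list.simps)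
  have w: "?w \<noteq> []" using len(1) assms(1) by auto
  have half: "j div 2 < level_size m" using assms by (simp add: level_size_Suc)
  have v: "?v = level_list m ! (j div 2) @ [if even j then 1 else 2]"
    by (rule level_list_Suc_nth[OF assms(1) j])
  have eq: "level_list m ! (j div 2) = ?w \<longleftrightarrow> j div 2 = i"
    by (rule nth_level_list_eq_iff[OF half i])
  \<comment> \<open>Halving a position gives the position of the parent, its parity the last letter.\<close>
  have "j = 2 * i \<longleftrightarrow> j div 2 = i \<and> even j" "j = 2 * i + 1 \<longleftrightarrow> j div 2 = i \<and> odd j"
    by presburger+
  then have 1: "?v = ?w @ [1] \<longleftrightarrow> j = 2 * i" and 2: "?v = ?w @ [2] \<longleftrightarrow> j = 2 * i + 1"
    unfolding v using eq by auto
  have "?v \<noteq> butlast ?w" "?v \<noteq> ?w"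
    using len by (auto dest!: arg_cong[of _ _ length] simp del: level_list.simps)
  then show ?thesis using 1 2 by (simp add: local_rule_unit_nonroot[OF w] del: level_list.simps)
qed

lemma parent_block_entry:
  assumes "m \<ge> 1" and i: "i < level_size (Suc m)" and j: "j < level_size m"
  shows "local_rule a b c d (unit_config (level_list m ! j)) (level_list (Suc m) ! i)
    = (if i = 2 * j \<or> i = 2 * j + 1 then c else 0)"
proof -
  let ?w = "level_list (Suc m) ! i" and ?v = "level_list m ! j"
  have len: "length ?w = Suc m" "length ?v = m"
    using assms by (simp_all add: length_in_level_list del: level_list.simps)
  have w: "?w \<noteq> []" using len(1) by auto
  have half: "i div 2 < level_size m" using assms by (simp add: level_size_Suc)
  have "?v = butlast ?w \<longleftrightarrow> j = i div 2"
    unfolding level_list_Suc_nth[OF assms(1) i] using nth_level_list_eq_iff[OF j half] by simp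
  then have eq: "?v = butlast ?w \<longleftrightarrow> i = 2 * j \<or> i = 2 * j + 1" by auto
  have "?v \<noteq> ?w @ [x]" "?v \<noteq> ?w" for x
    using len by (auto dest!: arg_cong[of _ _ length] simp del: level_list.simps)
  then show ?thesis using eq by (simp add: local_rule_unit_nonroot[OF w] del: level_list.simps)
qed

theorem theorem3p1:
  fixes a b c d :: "'p::prime_card mod_ring" and n :: nat
  assumes "a \<noteq> 0" and "b \<noteq> 0" and "c \<noteq> 0" and "d \<noteq> 0" and "n \<ge> 2"
  shows "(\<exists>!M. is_transition_rule_matrix n (null_boundary_ca n a b c d) M) \<and>
    (let M = transition_rule_matrix n (null_boundary_ca n a b c d) in
       M \<in> carrier_mat (1 + 3 * (2 ^ n - 1)) (1 + 3 * (2 ^ n - 1)) \<and>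
       (\<forall>k\<le>n. \<forall>l\<le>n. k + 1 < l \<or> l + 1 < k \<longrightarrow>
          level_block M k l = 0\<^sub>m (level_size k) (level_size l)) \<and>
       level_block M 0 0 = mat_of_rows_list 1 [[d]] \<and>
       level_block M 0 1 = mat_of_rows_list 3 [[a, b, c]] \<and>
       level_block M 1 0 = mat_of_cols_list 3 [[c, c, c]] \<and>
       (\<forall>m. 1 \<le> m \<and> m \<le> n \<longrightarrow>
          level_block M m m = d \<cdot>\<^sub>m 1\<^sub>m (3 * 2 ^ (m - 1))) \<and>
       (\<forall>m. 1 \<le> m \<and> m \<le> n - 1 \<longrightarrow>
          level_block M m (m + 1) = block_B a b (3 * 2 ^ (m - 1)) \<and>
          level_block M (m + 1) m = block_C c (3 * 2 ^ (m - 1))))"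
proof -
  let ?T = "null_boundary_ca n a b c d"
  define M where "M = transition_rule_matrix n ?T"
  have ex1: "\<exists>!M. is_transition_rule_matrix n ?T M" by (rule ex1_transition_rule_matrix)
  have M: "is_transition_rule_matrix n ?T M"
    unfolding M_def transition_rule_matrix_def by (rule theI'[OF ex1])
  note block = level_block_eq[OF M]
  have size: "level_size m = 3 * 2 ^ (m - 1)" if "m \<ge> 1" for m
    using that by (simp add: level_size_def)
  have carrier: "M \<in> carrier_mat (1 + 3 * (2 ^ n - 1)) (1 + 3 * (2 ^ n - 1))"
    using M by (simp only: is_transition_rule_matrix_def card_tree_ball level_offset_closed)
  have far: "level_block M k l = 0\<^sub>m (level_size k) (level_size l)"
    if "k \<le> n" "l \<le> n" "k + 1 < l \<or> l + 1 < k" for k l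
    unfolding block[OF that(1,2)] by (rule eq_matI) (simp_all add: far_block_entry[OF that(3)])
  have root: "level_block M 0 0 = mat_of_rows_list 1 [[d]]"
    by (rule eq_matI)
      (simp_all add: block mat_of_rows_list_def level_size_def local_rule_unit_root)
  have root_children: "level_block M 0 1 = mat_of_rows_list 3 [[a, b, c]]"
    using assms(5)
    by (intro eq_matI)
      (auto simp: block mat_of_rows_list_def level_size_def local_rule_unit_root less_Suc_eq
        numeral_3_eq_3)
  have root_parent: "level_block M 1 0 = mat_of_cols_list 3 [[c, c, c]]"
    using assms(5)
    by (intro eq_matI)
      (auto simp: block mat_of_cols_list_def level_size_def local_rule_unit_nonroot less_Suc_eq
        numeral_3_eq_3)
  have diag: "level_block M m m = d \<cdot>\<^sub>m 1\<^sub>m (3 * 2 ^ (m - 1))" if "1 \<le> m" "m \<le> n" for m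
    unfolding block[OF that(2,2)] size[OF that(1), symmetric]
    by (rule eq_matI) (simp_all add: diagonal_block_entry)
  have child: "level_block M m (m + 1) = block_B a b (3 * 2 ^ (m - 1))"
    and parent: "level_block M (m + 1) m = block_C c (3 * 2 ^ (m - 1))"
    if "1 \<le> m" "m \<le> n - 1" for m
  proof -
    have le: "m \<le> n" "m + 1 \<le> n" using that by auto
    note Suc_size = level_size_Suc[OF that(1)]
    show "level_block M m (m + 1) = block_B a b (3 * 2 ^ (m - 1))"
      unfolding block[OF le] size[OF that(1), symmetric] block_B_def
      by (rule eq_matI)
        (simp_all add: child_block_entry[OF that(1)] Suc_size del: level_list.simps)
    show "level_block M (m + 1) m = block_C c (3 * 2 ^ (m - 1))"
      unfolding block[OF le(2,1)] size[OF that(1), symmetric] block_C_def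
      by (rule eq_matI)
        (simp_all add: parent_block_entry[OF that(1)] Suc_size del: level_list.simps)
  qed
  show ?thesis
    unfolding Let_def M_def[symmetric]
    using ex1 carrier far root root_children root_parent diag child parent by blast
qed

end
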